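(* For every $A\in\mathbb{R}_+^{\infty\times\infty}$ we have $$r(A)=\max\{\mu(A),\,r'(A)\}.$$
   Context: $\mathbb{R}_+^{\infty\times\infty}$ is the set of infinite matrices $A=(a_{ij})_{i,j\in\mathbb{N}}$ with non-negative real entries and $\|A\|:=\sup\{a_{ij}:i,j\in\mathbb{N}\}<\infty$, where $\mathbb{N}=\{1,2,\dots\}$. The max-algebra product is $(A\otimes B)_{ij}=\sup_{k\in\mathbb{N}}a_{ik}b_{kj}$, and $A^k_\otimes$ is the $k$-th power of $A$ for $\otimes$. The max-algebra spectral radius is $r(A)=\lim_{k\to\infty}\|A^k_\otimes\|^{1/k}=\inf_k\|A^k_\otimes\|^{1/k}$ (the limit exists). For $i_0,\dots,i_k\in\mathbb{N}$ put $A(i_k,\dots,i_0)=\prod_{t=0}^{k-1}a_{i_{t+1}i_t}$. Define $$\mu(A)=\sup\{A(i_1,i_k,\dots,i_2,i_1)^{1/k}:k\in\mathbb{N},\ i_1,\dots,i_k\in\mathbb{N}\},$$ $$c_k(A)=\sup\{A(i_k,\dots,i_0): i_0,\dots,i_k\in\mathbb{N}\text{ mutually distinct}\},\qquad r'(A)=\limsup_{k\to\infty}c_k(A)^{1/k}.$$ *)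

theory Defs
  imports Complex_Main "HOL-Library.Extended_Real"
begin

text \<open>
  Rows and columns are labelled by the type \<open>nat\<close>, so labels start at 0 rather than 1.
\<close>

type_synonym inf_matrix = "nat \<Rightarrow> nat \<Rightarrow> real"

definition nonneg_bounded_matrices :: "inf_matrix set" where
  "nonneg_bounded_matrices =
     {A. (\<forall>i j. 0 \<le> A i j) \<and> bdd_above (range (\<lambda>(i, j). A i j))}"

definition matrix_norm :: "inf_matrix \<Rightarrow> real" where
  "matrix_norm A = (SUP (i, j) \<in> UNIV. A i j)"

definition max_times :: "inf_matrix \<Rightarrow> inf_matrix \<Rightarrow> inf_matrix"  (infixl "\<otimes>" 70) where
  "A \<otimes> B = (\<lambda>i j. SUP k. A i k * B k j)"

primrec max_power :: "inf_matrix \<Rightarrow> nat \<Rightarrow> inf_matrix" where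
  "max_power A 0 = (\<lambda>i j. if i = j then 1 else 0)"
| "max_power A (Suc k) = A \<otimes> max_power A k"

text \<open>The value of the sequence at \<open>k = 0\<close> (where \<open>root 0 x = 0\<close>) does not affect the limit.\<close>

definition max_spectral_radius :: "inf_matrix \<Rightarrow> real" where
  "max_spectral_radius A = lim (\<lambda>k. root k (matrix_norm (max_power A k)))"

text \<open>
  \<open>path_weight A k i\<close> is $A(i_k, \dots, i_0)$; only the values \<open>i 0, \<dots>, i k\<close> of the
  function \<open>i\<close> matter.
\<close>

definition path_weight :: "inf_matrix \<Rightarrow> nat \<Rightarrow> (nat \<Rightarrow> nat) \<Rightarrow> real" where
  "path_weight A k i = (\<Prod>t<k. A (i (Suc t)) (i t))"

text \<open>
  A cycle $(i_1, i_k, \dots, i_2, i_1)$ is a path with \<open>k\<close> steps whose vertices are numbered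
  from 0 and whose endpoints \<open>i 0\<close> and \<open>i k\<close> coincide.
\<close>

definition max_cycle_mean :: "inf_matrix \<Rightarrow> real" where
  "max_cycle_mean A = Sup {root k (path_weight A k i) | k i. 1 \<le> k \<and> i k = i 0}"

definition max_simple_path :: "nat \<Rightarrow> inf_matrix \<Rightarrow> real" where
  "max_simple_path k A = Sup {path_weight A k i | i. inj_on i {0..k}}"

definition simple_path_radius :: "inf_matrix \<Rightarrow> ereal" where
  "simple_path_radius A = limsup (\<lambda>k. ereal (root k (max_simple_path k A)))"

end

theory Submission
  imports Defs
begin

text \<open>
  The norm of the \<open>k\<close>-th power is the supremum \<open>n\<^sub>k\<close> of the weights of all paths with \<open>k\<close> steps.
  It is submultiplicative, so \<open>n\<^sub>k\<^bsup>1/k\<^esup>\<close> converges by Fekete's argument. The limit dominates every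
  cycle mean, because a cycle can be repeated, and it dominates the simple path radius termwise.
  Conversely, if \<open>x\<close> exceeds both quantities, then simple paths have weight at most \<open>C x\<^sup>k\<close>
  and cycles at most \<open>x\<^sup>k\<close>; cutting cycles out of a path until it is simple gives
  \<open>n\<^sub>k \<le> C x\<^sup>k\<close>, so the limit is at most \<open>x\<close>.
\<close>

section \<open>Roots of submultiplicative sequences\<close>

text \<open>\<open>root n C\<close> tends to 1, so a constant factor is invisible in the limit. This
  is why bounds up to a factor \<open>C\<close> suffice below.\<close>

lemma root_geometric_tendsto:
  assumes "0 < C" "0 \<le> x"
  shows "(\<lambda>n. root n (C * x ^ n)) \<longlonglongrightarrow> x"
proof -
  have "(\<lambda>n. root n C * x) \<longlonglongrightarrow> 1 * x"
    by (intro tendsto_intros LIMSEQ_root_const assms)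
  moreover have "eventually (\<lambda>n. root n C * x = root n (C * x ^ n)) sequentially"
    using eventually_gt_at_top[of 0]
    by eventually_elim (use assms in \<open>simp add: real_root_mult real_root_power_cancel\<close>)
  ultimately show ?thesis
    by (simp add: tendsto_cong)
qed

lemma root_limit_le_geometric:
  assumes "0 < C" "0 \<le> x" "\<And>n. u n \<le> C * x ^ n" "(\<lambda>n. root n (u n)) \<longlonglongrightarrow> L"
  shows "L \<le> x"
  using assms(4) root_geometric_tendsto[OF assms(1,2)]
proof (rule LIMSEQ_le)
  show "\<exists>N. \<forall>n\<ge>N. root n (u n) \<le> root n (C * x ^ n)"
    using assms(3) by (intro exI[of _ 1]) (auto intro!: real_root_le_mono)
qed

text \<open>Write \<open>n = q * k + s\<close> with \<open>s < k\<close>: each of the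
  \<open>q\<close> blocks of length \<open>k\<close> costs a factor \<open>x ^ k\<close>, and the
  finitely many remainders \<open>s\<close> are absorbed into \<open>C\<close>.\<close>

lemma submultiplicative_geometric_bound:
  fixes u :: "nat \<Rightarrow> real"
  assumes nonneg: "\<And>n. 0 \<le> u n" and submult: "\<And>m n. u (m + n) \<le> u m * u n"
    and k: "0 < k" "u k \<le> x ^ k" and "0 < x"
  shows "\<exists>C>0. \<forall>n. u n \<le> C * x ^ n"
proof -
  \<comment> \<open>The sum dominates every remainder term; the added 1 keeps \<open>C\<close>
    positive even if all of these vanish.\<close>
  define C where "C = (\<Sum>s<k. u s / x ^ s) + 1"
  have "0 < C"
    unfolding C_def using nonneg \<open>0 < x\<close>
    by (intro add_nonneg_pos sum_nonneg) auto
  have remainder: "u s \<le> C * x ^ s" if "s < k" for s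
  proof -
    have "u s / x ^ s \<le> (\<Sum>s<k. u s / x ^ s)"
      using that nonneg \<open>0 < x\<close> by (intro member_le_sum) auto
    then have "u s / x ^ s \<le> C"
      by (simp add: C_def)
    then show ?thesis
      using \<open>0 < x\<close> by (simp add: divide_le_eq)
  qed
  have "u (q * k + s) \<le> C * x ^ (q * k + s)" if "s < k" for q s
  proof (induction q)
    case 0
    show ?case using remainder[OF that] by simp
  next
    case (Suc q)
    have "u (Suc q * k + s) \<le> u k * u (q * k + s)"
      using submult[of k "q * k + s"] by (simp add: add.assoc)
    also have "\<dots> \<le> x ^ k * (C * x ^ (q * k + s))"
      using k Suc nonneg \<open>0 < x\<close> by (intro mult_mono) auto
    also have "\<dots> = C * x ^ (Suc q * k + s)"
      by (simp add: power_add)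
    finally show ?case .
  qed
  from this[of "n mod k" "n div k" for n] \<open>0 < C\<close> \<open>0 < k\<close> show ?thesis
    by auto
qed

text \<open>Fekete's argument: the limit is the infimum of the roots over \<open>n >= 1\<close>.
  Index 0 is left out because \<open>root 0\<close> is constantly 0 and would spoil the
  infimum.\<close>

lemma submultiplicative_root_convergent:
  fixes u :: "nat \<Rightarrow> real"
  assumes nonneg: "\<And>n. 0 \<le> u n" and submult: "\<And>m n. u (m + n) \<le> u m * u n"
  shows "convergent (\<lambda>n. root n (u n))"
proof -
  let ?S = "(\<lambda>n. root n (u n)) ` {1..}"
  have bdd: "bdd_below ?S"
    using nonneg by (intro bdd_belowI2[of _ 0]) auto
  have "0 \<le> Inf ?S"
    using nonneg by (intro cINF_greatest) auto
  have "(\<lambda>n. root n (u n)) \<longlonglongrightarrow> Inf ?S"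
  proof (rule order_tendstoI)
    fix y assume "y < Inf ?S"
    show "eventually (\<lambda>n. y < root n (u n)) sequentially"
      using eventually_ge_at_top[of 1]
    proof eventually_elim
      case (elim n)
      then have "Inf ?S \<le> root n (u n)"
        by (intro cINF_lower bdd) auto
      with \<open>y < Inf ?S\<close> show ?case by simp
    qed
  next
    fix y assume "Inf ?S < y"
    \<comment> \<open>The gap between \<open>x\<close> and \<open>y\<close> leaves room for the
      constant in the geometric bound.\<close>
    then obtain x where x: "Inf ?S < x" "x < y"
      using dense by blast
    with \<open>0 \<le> Inf ?S\<close> have "0 < x" by simp
    from x(1) obtain k where k: "1 \<le> k" "root k (u k) < x"
      by (subst (asm) cINF_less_iff[OF _ bdd]) auto
    have "u k = root k (u k) ^ k"
      using k nonneg by simp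
    also have "\<dots> \<le> x ^ k"
      using k nonneg by (intro power_mono) auto
    finally obtain C where C: "0 < C" "\<And>n. u n \<le> C * x ^ n"
      using submultiplicative_geometric_bound[OF assms, of k x] k \<open>0 < x\<close> by auto
    have "eventually (\<lambda>n. root n (C * x ^ n) < y) sequentially"
      using root_geometric_tendsto[of C x] C \<open>0 < x\<close> x(2) by (intro order_tendstoD(2)) auto
    then show "eventually (\<lambda>n. root n (u n) < y) sequentially"
      using eventually_gt_at_top[of 0]
    proof eventually_elim
      case (elim n)
      then show ?case
        using real_root_le_mono[of n "u n" "C * x ^ n"] C(2)[of n] by linarith
    qed
  qed
  then show ?thesis
    by (rule convergentI)
qed

section \<open>Path weights, repeated cycles and cycle removal\<close>

lemma path_weight_0 [simp]: "path_weight A 0 i = 1"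
  by (simp add: path_weight_def)

lemma path_weight_Suc: "path_weight A (Suc k) i = A (i (Suc k)) (i k) * path_weight A k i"
  by (simp add: path_weight_def mult.commute)

lemma path_weight_add:
  "path_weight A (m + k) i = path_weight A m i * path_weight A k (\<lambda>t. i (m + t))"
  by (induction k) (simp_all add: path_weight_Suc)

lemma path_weight_cong:
  assumes "\<And>t. t \<le> k \<Longrightarrow> i t = j t"
  shows "path_weight A k i = path_weight A k j"
  unfolding path_weight_def using assms by (intro prod.cong) auto

lemma path_weight_nonneg:
  assumes "\<And>i j. 0 \<le> A i j"
  shows "0 \<le> path_weight A k i"
  unfolding path_weight_def by (intro prod_nonneg) (simp add: assms)

lemma path_weight_repeat_cycle:
  assumes "i k = i 0"
  shows "path_weight A (m * k) (\<lambda>t. i (t mod k)) = path_weight A k i ^ m"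
proof (induction m)
  case (Suc m)
  \<comment> \<open>Only \<open>t = k\<close> matters: there \<open>t mod k\<close> wraps around to
    0, and the cycle condition identifies the two vertices.\<close>
  have "path_weight A k (\<lambda>t. i (t mod k)) = path_weight A k i"
    by (rule path_weight_cong) (metis assms le_neq_implies_less mod_less mod_self)
  then show ?case
    by (simp add: path_weight_add Suc)
qed simp

text \<open>Induction on the length: a path that is not simple revisits a vertex, so its weight is
  that of a cycle of length \<open>d\<close> times that of a path shorter by \<open>d\<close>. The
  factor \<open>C\<close> is paid only once, for the simple path left at the end.\<close>

lemma path_weight_le_by_cutting_cycles:
  fixes C x :: real
  assumes nonneg: "\<And>i j. 0 \<le> A i j" and "0 \<le> C" "0 \<le> x"
    and simple: "\<And>k i. inj_on i {0..k} \<Longrightarrow> path_weight A k i \<le> C * x ^ k"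
    and cycle: "\<And>k i. 1 \<le> k \<Longrightarrow> i k = i 0 \<Longrightarrow> path_weight A k i \<le> x ^ k"
  shows "path_weight A k i \<le> C * x ^ k"
proof (induction k arbitrary: i rule: less_induct)
  case (less k)
  show ?case
  proof (cases "inj_on i {0..k}")
    case True
    then show ?thesis by (rule simple)
  next
    case False
    then obtain a b where "a < b" "b \<le> k" and ab: "i a = i b"
      unfolding inj_on_def by (metis atLeastAtMost_iff linorder_neqE_nat)
    define d where "d = b - a"
    define r where "r = k - b"
    have k: "k = (a + d) + r" and "0 < d" and ad: "a + d = b"
      using \<open>a < b\<close> \<open>b \<le> k\<close> by (auto simp: d_def r_def)
    \<comment> \<open>The path with the closed segment from \<open>a\<close> to \<open>b\<close>
      removed; the two pieces join because \<open>i a = i b\<close>.\<close>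
    define j where "j t = (if t \<le> a then i t else i (t + d))" for t
    have "path_weight A a j = path_weight A a i"
      by (rule path_weight_cong) (simp add: j_def)
    moreover have "path_weight A r (\<lambda>t. j (a + t)) = path_weight A r (\<lambda>t. i (a + d + t))"
      by (rule path_weight_cong) (auto simp: j_def ab ad ac_simps)
    ultimately have "path_weight A k i
        = path_weight A (a + r) j * path_weight A d (\<lambda>t. i (a + t))"
      by (simp add: k path_weight_add)
    also have "\<dots> \<le> (C * x ^ (a + r)) * x ^ d"
    proof (intro mult_mono)
      show "path_weight A (a + r) j \<le> C * x ^ (a + r)"
        using less.IH \<open>0 < d\<close> by (simp add: k)
      show "path_weight A d (\<lambda>t. i (a + t)) \<le> x ^ d"
        using cycle[of d "\<lambda>t. i (a + t)"] \<open>0 < d\<close> ab ad by simp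
    qed (use assms path_weight_nonneg in auto)
    also have "\<dots> = C * x ^ k"
      by (simp add: k power_add ac_simps)
    finally show ?thesis .
  qed
qed

section \<open>Max-algebra powers as suprema of path weights\<close>

context
  fixes A :: inf_matrix
  assumes A: "A \<in> nonneg_bounded_matrices"
begin

lemma entry_nonneg: "0 \<le> A i j"
  using A by (simp add: nonneg_bounded_matrices_def)

lemma entry_le_norm: "A i j \<le> matrix_norm A"
  using A cSUP_upper[of "(i, j)" UNIV "\<lambda>(i, j). A i j"]
  by (simp add: nonneg_bounded_matrices_def matrix_norm_def)

lemma matrix_norm_nonneg: "0 \<le> matrix_norm A"
  using entry_nonneg[of 0 0] entry_le_norm[of 0 0] by linarith

lemma path_weight_le_norm_power: "path_weight A k i \<le> matrix_norm A ^ k"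
proof -
  have "path_weight A k i \<le> (\<Prod>t<k. matrix_norm A)"
    unfolding path_weight_def by (intro prod_mono) (simp add: entry_nonneg entry_le_norm)
  then show ?thesis by simp
qed

text \<open>A real \<open>SUP\<close> is informative only for a bounded family, so the upper bound
  is carried through the induction.\<close>

lemma max_power_bounds: "0 \<le> max_power A k a b \<and> max_power A k a b \<le> matrix_norm A ^ k"
proof (induction k arbitrary: a b)
  case (Suc k)
  have bounds: "0 \<le> A a c * max_power A k c b"
    "A a c * max_power A k c b \<le> matrix_norm A ^ Suc k" for c
    using Suc[of c b] entry_nonneg[of a c] entry_le_norm[of a c] matrix_norm_nonneg
    by (auto intro!: mult_mono)
  have "bdd_above (range (\<lambda>c. A a c * max_power A k c b))"
    using bounds(2) by (rule bdd_aboveI2)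
  then have "0 \<le> (SUP c. A a c * max_power A k c b)"
    using bounds(1)[of 0] by (intro cSUP_upper2[where x = 0]) auto
  moreover have "(SUP c. A a c * max_power A k c b) \<le> matrix_norm A ^ Suc k"
    using bounds(2) by (intro cSUP_least) auto
  ultimately show ?case
    by (simp add: max_times_def)
qed simp

lemma entry_times_le_max_power_Suc:
  "A a c * max_power A k c b \<le> max_power A (Suc k) a b"
proof -
  have "A a c * max_power A k c b \<le> matrix_norm A * matrix_norm A ^ k" for c
    using max_power_bounds[of k c b] entry_nonneg[of a c] entry_le_norm[of a c] matrix_norm_nonneg
    by (intro mult_mono) auto
  then have "bdd_above (range (\<lambda>c. A a c * max_power A k c b))"
    by (rule bdd_aboveI2)
  then show ?thesis
    using cSUP_upper[of c UNIV "\<lambda>c. A a c * max_power A k c b"] by (simp add: max_times_def)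
qed

lemma path_weight_le_max_power: "path_weight A k i \<le> max_power A k (i k) (i 0)"
proof (induction k)
  case (Suc k)
  have "path_weight A (Suc k) i \<le> A (i (Suc k)) (i k) * max_power A k (i k) (i 0)"
    using Suc by (simp add: path_weight_Suc mult_left_mono entry_nonneg)
  also have "\<dots> \<le> max_power A (Suc k) (i (Suc k)) (i 0)"
    by (rule entry_times_le_max_power_Suc)
  finally show ?case .
qed simp

text \<open>With \<open>path_weight_le_max_power\<close> this identifies the entry as a least upper
  bound of path weights. The bound \<open>B\<close> is general so that the induction can pass to
  \<open>B / A a c\<close>; \<open>0 <= B\<close> covers zero entries, such as off-diagonal ones for
  \<open>k = 0\<close>.\<close>

lemma max_power_least:
  assumes "\<And>i. i k = a \<Longrightarrow> i 0 = b \<Longrightarrow> path_weight A k i \<le> B" "0 \<le> B"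
  shows "max_power A k a b \<le> B"
  using assms
proof (induction k arbitrary: a B)
  case 0
  then show ?case using "0.prems"(1)[of "\<lambda>_. b"] by auto
next
  case (Suc k)
  have "A a c * max_power A k c b \<le> B" for c
  proof (cases "A a c = 0")
    case False
    then have pos: "0 < A a c"
      using entry_nonneg[of a c] by simp
    have "max_power A k c b \<le> B / A a c"
    proof (rule Suc.IH)
      fix i assume i: "i k = c" "i 0 = b"
      \<comment> \<open>Appending the vertex \<open>a\<close> turns a path ending in
        \<open>c\<close> into one to which the bound \<open>B\<close> applies.\<close>
      have "path_weight A k (\<lambda>t. if t = Suc k then a else i t) = path_weight A k i"
        by (rule path_weight_cong) simp
      then have "A a c * path_weight A k i \<le> B"
        using Suc.prems(1)[of "\<lambda>t. if t = Suc k then a else i t"] i by (simp add: path_weight_Suc)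
      then show "path_weight A k i \<le> B / A a c"
        using pos by (simp add: le_divide_eq mult.commute)
    qed (use Suc.prems pos in simp)
    then show ?thesis
      using pos by (simp add: le_divide_eq mult.commute)
  qed (use Suc.prems in simp)
  then show ?case
    by (simp add: max_times_def cSUP_least)
qed

lemma path_weight_le_norm_max_power: "path_weight A k i \<le> matrix_norm (max_power A k)"
proof -
  have "bdd_above (range (\<lambda>(a, b). max_power A k a b))"
    using max_power_bounds[of k] by (intro bdd_aboveI2[of _ _ "matrix_norm A ^ k"]) auto
  then have "max_power A k (i k) (i 0) \<le> matrix_norm (max_power A k)"
    using cSUP_upper[of "(i k, i 0)" UNIV "\<lambda>(a, b). max_power A k a b"]
    by (simp add: matrix_norm_def)
  with path_weight_le_max_power[of k i] show ?thesis
    by linarith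
qed

lemma norm_max_power_least:
  assumes "\<And>i. path_weight A k i \<le> B"
  shows "matrix_norm (max_power A k) \<le> B"
proof -
  have "0 \<le> path_weight A k id"
    by (rule path_weight_nonneg) (rule entry_nonneg)
  then have "0 \<le> B"
    using assms[of id] by simp
  then show ?thesis
    unfolding matrix_norm_def using assms by (intro cSUP_least) (auto intro: max_power_least)
qed

lemma norm_max_power_nonneg: "0 \<le> matrix_norm (max_power A k)"
  using path_weight_nonneg[of A k id] path_weight_le_norm_max_power[of k id] entry_nonneg
  by force

text \<open>A path of \<open>m + k\<close> steps splits after \<open>m\<close> steps into two paths,
  each bounded by the corresponding norm.\<close>

lemma norm_max_power_add:
  "matrix_norm (max_power A (m + k)) \<le> matrix_norm (max_power A m) * matrix_norm (max_power A k)"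
  by (rule norm_max_power_least)
    (auto simp: path_weight_add entry_nonneg
      intro!: mult_mono path_weight_le_norm_max_power norm_max_power_nonneg path_weight_nonneg)

lemma max_spectral_radius_tendsto:
  "(\<lambda>k. root k (matrix_norm (max_power A k))) \<longlonglongrightarrow> max_spectral_radius A"
  using submultiplicative_root_convergent[OF norm_max_power_nonneg norm_max_power_add]
  by (simp add: max_spectral_radius_def convergent_LIMSEQ_iff)

section \<open>Suprema over cycles and over simple paths\<close>

lemma cycle_mean_le:
  assumes "1 \<le> k" "i k = i 0"
  shows "root k (path_weight A k i) \<le> max_cycle_mean A"
  unfolding max_cycle_mean_def
proof (rule cSup_upper)
  have "root k (path_weight A k i) \<le> matrix_norm A" if "1 \<le> k" for k i
  proof -
    have "root k (path_weight A k i) \<le> root k (matrix_norm A ^ k)"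
      using that path_weight_le_norm_power by simp
    then show ?thesis
      using that matrix_norm_nonneg by (simp add: real_root_power_cancel)
  qed
  then show "bdd_above {root k (path_weight A k i) | k i. 1 \<le> k \<and> i k = i 0}"
    by (intro bdd_aboveI[of _ "matrix_norm A"]) auto
qed (use assms in blast)

lemma max_cycle_mean_nonneg: "0 \<le> max_cycle_mean A"
  using cycle_mean_le[of 1 "\<lambda>_. 0"] path_weight_nonneg[of A 1 "\<lambda>_. 0"] entry_nonneg
  by fastforce

lemma path_weight_le_max_simple_path:
  assumes "inj_on i {0..k}"
  shows "path_weight A k i \<le> max_simple_path k A"
  unfolding max_simple_path_def
proof (rule cSup_upper)
  show "bdd_above {path_weight A k i | i. inj_on i {0..k}}"
    using path_weight_le_norm_power by (intro bdd_aboveI[of _ "matrix_norm A ^ k"]) auto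
qed (use assms in blast)

lemma max_simple_path_least:
  assumes "\<And>i. inj_on i {0..k} \<Longrightarrow> path_weight A k i \<le> B"
  shows "max_simple_path k A \<le> B"
  unfolding max_simple_path_def
proof (rule cSup_least)
  have "inj_on id {0..k}" by simp
  then show "{path_weight A k i | i. inj_on i {0..k}} \<noteq> {}"
    by blast
qed (use assms in blast)

section \<open>The spectral radius compared with the two quantities\<close>

lemma max_cycle_mean_le_spectral_radius: "max_cycle_mean A \<le> max_spectral_radius A"
  unfolding max_cycle_mean_def
proof (rule cSup_least)
  have "root 1 (path_weight A 1 (\<lambda>_. 0)) \<in> {root k (path_weight A k i) | k i. 1 \<le> k \<and> i k = i 0}"
    unfolding mem_Collect_eq by (rule exI[of _ 1], rule exI[of _ "\<lambda>_. 0"]) simp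
  then show "{root k (path_weight A k i) | k i. 1 \<le> k \<and> i k = i 0} \<noteq> {}"
    unfolding ex_in_conv[symmetric] by (rule exI)
next
  fix w assume "w \<in> {root k (path_weight A k i) | k i. 1 \<le> k \<and> i k = i 0}"
  then obtain k i where k: "1 \<le> k" and i: "i k = i 0" and w: "w = root k (path_weight A k i)"
    by blast
  \<comment> \<open>The lengths of the repeated cycle form a subsequence; \<open>Suc m\<close> keeps
    them positive. Repetition leaves the geometric mean \<open>w\<close> unchanged, so
    \<open>w\<close> bounds this subsequence from below.\<close>
  have "strict_mono (\<lambda>m. Suc m * k)"
    using k by (intro strict_monoI) simp
  with max_spectral_radius_tendsto
  have "(\<lambda>m. root (Suc m * k) (matrix_norm (max_power A (Suc m * k)))) \<longlonglongrightarrow> max_spectral_radius A"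
    by (auto dest: LIMSEQ_subseq_LIMSEQ simp: o_def)
  moreover have "w \<le> root (Suc m * k) (matrix_norm (max_power A (Suc m * k)))" for m
  proof -
    have "0 \<le> path_weight A k i"
      by (rule path_weight_nonneg) (rule entry_nonneg)
    then have "w = root k (root (Suc m) (path_weight A k i ^ Suc m))"
      by (simp only: w real_root_power_cancel zero_less_Suc)
    also have "\<dots> = root (Suc m * k) (path_weight A k i ^ Suc m)"
      by (simp only: real_root_mult_exp real_root_commute[of k])
    also have "\<dots> \<le> root (Suc m * k) (matrix_norm (max_power A (Suc m * k)))"
      using k path_weight_le_norm_max_power[of "Suc m * k" "\<lambda>t. i (t mod k)"]
      unfolding path_weight_repeat_cycle[OF i] by (intro real_root_le_mono) auto
    finally show ?thesis .
  qed
  ultimately show "w \<le> max_spectral_radius A"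
    by (auto intro: LIMSEQ_le_const)
qed

lemma simple_path_radius_le_spectral_radius: "simple_path_radius A \<le> ereal (max_spectral_radius A)"
proof -
  have "simple_path_radius A \<le> limsup (\<lambda>k. ereal (root k (matrix_norm (max_power A k))))"
    unfolding simple_path_radius_def
  proof (rule Limsup_mono, rule eventually_mono[OF eventually_gt_at_top[of 0]])
    fix k :: nat assume "0 < k"
    moreover have "max_simple_path k A \<le> matrix_norm (max_power A k)"
      by (intro max_simple_path_least path_weight_le_norm_max_power)
    ultimately show "ereal (root k (max_simple_path k A))
        \<le> ereal (root k (matrix_norm (max_power A k)))"
      by simp
  qed
  also have "\<dots> = ereal (max_spectral_radius A)"
    using max_spectral_radius_tendsto by (intro lim_imp_Limsup) auto
  finally show ?thesis .
qed

text \<open>The strict inequalities bound all cycles by \<open>x ^ k\<close> and all sufficiently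
  long simple paths by \<open>x ^ k\<close>, which is the input for cutting cycles.\<close>

lemma max_spectral_radius_le:
  assumes mean: "max_cycle_mean A < x" and radius: "simple_path_radius A < ereal x"
  shows "max_spectral_radius A \<le> x"
proof -
  have "0 < x"
    using mean max_cycle_mean_nonneg by linarith
  have "eventually (\<lambda>k. ereal (root k (max_simple_path k A)) < ereal x) sequentially"
    using radius unfolding simple_path_radius_def by (rule Limsup_lessD)
  then obtain K where K: "\<And>k. K \<le> k \<Longrightarrow> root k (max_simple_path k A) < x"
    by (auto simp: eventually_sequentially)
  \<comment> \<open>The sum handles the simple paths with at most \<open>K\<close> steps; the added
    1 gives \<open>1 <= C\<close> for the longer ones.\<close>
  define C where "C = (\<Sum>k\<le>K. matrix_norm A ^ k / x ^ k) + 1"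
  have "1 \<le> C"
    unfolding C_def using matrix_norm_nonneg \<open>0 < x\<close> by (simp add: sum_nonneg)
  have simple: "path_weight A k i \<le> C * x ^ k" if inj: "inj_on i {0..k}" for k i
  proof (cases "k \<le> K")
    case True
    then have "matrix_norm A ^ k / x ^ k \<le> (\<Sum>k\<le>K. matrix_norm A ^ k / x ^ k)"
      using matrix_norm_nonneg \<open>0 < x\<close> by (intro member_le_sum) auto
    then have "matrix_norm A ^ k / x ^ k \<le> C"
      by (simp add: C_def)
    then have "matrix_norm A ^ k \<le> C * x ^ k"
      using \<open>0 < x\<close> by (simp add: divide_le_eq)
    with path_weight_le_norm_power[of k i] show ?thesis
      by linarith
  next
    case False
    have nonneg: "0 \<le> path_weight A k i"
      by (rule path_weight_nonneg) (rule entry_nonneg)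
    have le: "path_weight A k i \<le> max_simple_path k A"
      by (rule path_weight_le_max_simple_path[OF inj])
    have "path_weight A k i \<le> root k (max_simple_path k A) ^ k"
      using False nonneg le by simp
    also have "\<dots> \<le> x ^ k"
      using False K[of k] nonneg le by (intro power_mono) auto
    also have "\<dots> = 1 * x ^ k"
      by simp
    also have "\<dots> \<le> C * x ^ k"
      using \<open>1 \<le> C\<close> \<open>0 < x\<close> by (intro mult_right_mono) auto
    finally show ?thesis .
  qed
  have cycle: "path_weight A k i \<le> x ^ k" if "1 \<le> k" "i k = i 0" for k i
  proof -
    have nonneg: "0 \<le> path_weight A k i"
      by (rule path_weight_nonneg) (rule entry_nonneg)
    then have "path_weight A k i = root k (path_weight A k i) ^ k"
      using that by simp
    also have "\<dots> \<le> x ^ k"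
      using cycle_mean_le[of k i] that mean nonneg by (intro power_mono) auto
    finally show ?thesis .
  qed
  have "path_weight A k i \<le> C * x ^ k" for k i
    by (rule path_weight_le_by_cutting_cycles[OF entry_nonneg _ _ simple cycle])
      (use \<open>1 \<le> C\<close> \<open>0 < x\<close> in auto)
  then have "matrix_norm (max_power A k) \<le> C * x ^ k" for k
    by (rule norm_max_power_least)
  then show ?thesis
    by (rule root_limit_le_geometric[OF _ _ _ max_spectral_radius_tendsto, rotated 2])
      (use \<open>1 \<le> C\<close> \<open>0 < x\<close> in auto)
qed

end

theorem theorem3p1:
  fixes A :: inf_matrix
  assumes "A \<in> nonneg_bounded_matrices"
  shows "ereal (max_spectral_radius A) =
           max (ereal (max_cycle_mean A)) (simple_path_radius A)"
proof (rule antisym)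
  show "ereal (max_spectral_radius A) \<le> max (ereal (max_cycle_mean A)) (simple_path_radius A)"
  proof (rule ccontr)
    assume "\<not> ?thesis"
    \<comment> \<open>Density supplies a real \<open>x\<close> strictly in between, although the
      simple path radius is a priori only an extended real.\<close>
    then obtain x where "max (ereal (max_cycle_mean A)) (simple_path_radius A) < ereal x"
      and "ereal x < ereal (max_spectral_radius A)"
      using ereal_dense2 by (metis not_le)
    with max_spectral_radius_le[OF assms, of x] show False
      by simp
  qed
  show "max (ereal (max_cycle_mean A)) (simple_path_radius A) \<le> ereal (max_spectral_radius A)"
    using max_cycle_mean_le_spectral_radius[OF assms] simple_path_radius_le_spectral_radius[OF assms]
    by simp
qed

end
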